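(* Let $\Sigma=(\Gamma,\sigma)$ be a signed graph with underlying graph $\Gamma=(V,E)$ and $G$ a finite additive abelian group. The number of $G$-tensions of $\Sigma$ is $t^0_\Sigma(G)=|G|^{|V|-k_b(\Sigma)}$, and the number of $G$-potential differences of $\Sigma$ is $p^0_\Sigma(G)=|G|^{|V|-k(\Sigma)}|2G|^{k_u(\Sigma)}$.
   Context: A signed graph $\Sigma=(\Gamma,\sigma)$: finite graph $\Gamma=(V,E)$ (loops, multiple edges allowed), $\sigma:E\to\{-1,1\}$. A cycle (loops included) is balanced if the product of its edge signs is $1$, unbalanced otherwise. $k,k_b,k_u$: numbers of connected components, balanced components (all cycles balanced), unbalanced components. Each edge $e$ with endpoints $u,v$ has half-edges $(u,e),(v,e)$; an orientation $\omega$ assigns $\pm1$ to each half-edge, compatible with $\sigma$ if $\sigma(e)=-\omega(u,e)\omega(v,e)$; fix one (counts do not depend on it). A walk $(v_1,e_1,\dots,v_k,e_k,v_{k+1})$ has $e_i$ joining $v_i,v_{i+1}$; $\omega(v_i,e_i)$ is the orientation of the half-edge of $e_i$ at $v_i$ by which the walk leaves $v_i$. Circuits of $\Sigma$: edge sets of balanced cycles, of unbalanced tight handcuffs (two unbalanced cycles sharing exactly one vertex) and of unbalanced loose handcuffs (two vertex-disjoint unbalanced cycles joined by a path meeting them only at its endpoints, whose edges are circuit path edges). A circuit walk is a closed walk traversing a circuit using circuit path edges twice and other edges once. $f:E\to G$ is a $G$-tension if for every circuit walk $(v_1,e_1,\dots,v_k,e_k,v_1)$, $\sum_{i=1}^k\big(\omega(v_i,e_i)\prod_{j<i}\sigma(e_j)\big)f(e_i)=0$;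 a $G$-potential difference if additionally $\sum_if(e_i)\in2G=\{x+x:x\in G\}$ for every closed walk around an unbalanced cycle. Zero values are allowed. *)

theory Defs
  imports Main "HOL-Library.FuncSet" "HOL-Library.Cardinality"
begin

text \<open>
  The two half-edges of an edge \<open>e\<close> are \<open>(e, True)\<close> and \<open>(e, False)\<close>; the naming of the two
  ends is arbitrary. Indexing by a Boolean instead of by the incident vertex keeps the two
  half-edges of a loop apart. The function \<open>endpoint\<close> gives the vertex at which a half-edge sits.
\<close>

record ('v, 'e) sgraph =
  verts :: "'v set"
  edges :: "'e set"
  endpoint :: "'e \<times> bool \<Rightarrow> 'v"
  esign :: "'e \<Rightarrow> int"

definition signed_graph :: "('v, 'e) sgraph \<Rightarrow> bool" where
  "signed_graph S \<longleftrightarrow>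
     finite (verts S) \<and> finite (edges S) \<and>
     (\<forall>e\<in>edges S. \<forall>b. endpoint S (e, b) \<in> verts S) \<and>
     (\<forall>e\<in>edges S. esign S e \<in> {-1, 1})"

definition compatible_orientation :: "('v, 'e) sgraph \<Rightarrow> ('e \<times> bool \<Rightarrow> int) \<Rightarrow> bool" where
  "compatible_orientation S \<omega> \<longleftrightarrow>
     (\<forall>e\<in>edges S. (\<forall>b. \<omega> (e, b) \<in> {-1, 1}) \<and>
        esign S e = - (\<omega> (e, True) * \<omega> (e, False)))"

text \<open>
  A walk is given by its initial vertex and the list of half-edges by which it leaves
  its successive vertices.
\<close>

definition leaves :: "('v, 'e) sgraph \<Rightarrow> 'e \<times> bool \<Rightarrow> 'v" where
  "leaves S h = endpoint S h"

definition arrives :: "('v, 'e) sgraph \<Rightarrow> 'e \<times> bool \<Rightarrow> 'v" where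
  "arrives S h = endpoint S (fst h, \<not> snd h)"

fun walk :: "('v, 'e) sgraph \<Rightarrow> 'v \<Rightarrow> ('e \<times> bool) list \<Rightarrow> 'v \<Rightarrow> bool" where
  "walk S u [] v \<longleftrightarrow> u \<in> verts S \<and> u = v"
| "walk S u (h # hs) v \<longleftrightarrow> fst h \<in> edges S \<and> leaves S h = u \<and> walk S (arrives S h) hs v"

definition closed_walk :: "('v, 'e) sgraph \<Rightarrow> ('e \<times> bool) list \<Rightarrow> bool" where
  "closed_walk S hs \<longleftrightarrow> hs \<noteq> [] \<and> walk S (leaves S (hd hs)) hs (leaves S (hd hs))"

definition edges_of :: "('e \<times> bool) list \<Rightarrow> 'e set" where
  "edges_of hs = fst ` set hs"

text \<open>
  Loops are the cycles of length 1; distinctness of the edges excludes going back and forth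
  along a single edge.
\<close>

definition cycle_walk :: "('v, 'e) sgraph \<Rightarrow> ('e \<times> bool) list \<Rightarrow> bool" where
  "cycle_walk S hs \<longleftrightarrow>
     closed_walk S hs \<and> distinct (map (leaves S) hs) \<and> distinct (map fst hs)"

definition cycle :: "('v, 'e) sgraph \<Rightarrow> 'e set \<Rightarrow> bool" where
  "cycle S C \<longleftrightarrow> (\<exists>hs. cycle_walk S hs \<and> edges_of hs = C)"

definition balanced_cycle :: "('v, 'e) sgraph \<Rightarrow> 'e set \<Rightarrow> bool" where
  "balanced_cycle S C \<longleftrightarrow> cycle S C \<and> (\<Prod>e\<in>C. esign S e) = 1"

definition unbalanced_cycle :: "('v, 'e) sgraph \<Rightarrow> 'e set \<Rightarrow> bool" where
  "unbalanced_cycle S C \<longleftrightarrow> cycle S C \<and> (\<Prod>e\<in>C. esign S e) \<noteq> 1"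

definition edge_verts :: "('v, 'e) sgraph \<Rightarrow> 'e set \<Rightarrow> 'v set" where
  "edge_verts S C = endpoint S ` (C \<times> UNIV)"

definition components :: "('v, 'e) sgraph \<Rightarrow> 'v set set" where
  "components S = verts S // {(u, v). u \<in> verts S \<and> v \<in> verts S \<and> (\<exists>hs. walk S u hs v)}"

definition balanced_component :: "('v, 'e) sgraph \<Rightarrow> 'v set \<Rightarrow> bool" where
  "balanced_component S X \<longleftrightarrow> X \<in> components S \<and>
     (\<forall>C. cycle S C \<and> edge_verts S C \<subseteq> X \<longrightarrow> balanced_cycle S C)"

definition num_components :: "('v, 'e) sgraph \<Rightarrow> nat" where
  "num_components S = card (components S)"

definition num_balanced :: "('v, 'e) sgraph \<Rightarrow> nat" where
  "num_balanced S = card {X \<in> components S. balanced_component S X}"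

definition num_unbalanced :: "('v, 'e) sgraph \<Rightarrow> nat" where
  "num_unbalanced S = card {X \<in> components S. \<not> balanced_component S X}"

definition path :: "('v, 'e) sgraph \<Rightarrow> 'v \<Rightarrow> ('e \<times> bool) list \<Rightarrow> 'v \<Rightarrow> bool" where
  "path S u hs v \<longleftrightarrow> walk S u hs v \<and> distinct (u # map (arrives S) hs)"

text \<open>
  \<open>circuit S C P\<close>: \<open>C\<close> is a circuit and \<open>P \<subseteq> C\<close> is its set of circuit path edges.
  In a tight handcuff \<open>C1 \<noteq> C2\<close> is needed because a loop shares exactly one vertex with itself.
\<close>

inductive circuit :: "('v, 'e) sgraph \<Rightarrow> 'e set \<Rightarrow> 'e set \<Rightarrow> bool" for S where
  balanced: "balanced_cycle S C \<Longrightarrow> circuit S C {}"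
| tight_handcuff:
    "unbalanced_cycle S C1 \<Longrightarrow> unbalanced_cycle S C2 \<Longrightarrow> C1 \<noteq> C2 \<Longrightarrow>
     edge_verts S C1 \<inter> edge_verts S C2 = {v} \<Longrightarrow> circuit S (C1 \<union> C2) {}"
| loose_handcuff:
    "unbalanced_cycle S C1 \<Longrightarrow> unbalanced_cycle S C2 \<Longrightarrow>
     edge_verts S C1 \<inter> edge_verts S C2 = {} \<Longrightarrow> path S u hs w \<Longrightarrow>
     set (u # map (arrives S) hs) \<inter> edge_verts S C1 = {u} \<Longrightarrow>
     set (u # map (arrives S) hs) \<inter> edge_verts S C2 = {w} \<Longrightarrow>
     circuit S (C1 \<union> C2 \<union> edges_of hs) (edges_of hs)"

definition circuit_walk :: "('v, 'e) sgraph \<Rightarrow> ('e \<times> bool) list \<Rightarrow> bool" where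
  "circuit_walk S hs \<longleftrightarrow> closed_walk S hs \<and>
     (\<exists>C P. circuit S C P \<and> edges_of hs = C \<and>
        (\<forall>e\<in>C. count_list (map fst hs) e = (if e \<in> P then 2 else 1)))"

text \<open>The action of a sign \<open>s \<in> {-1, 1}\<close> on an abelian group.\<close>

definition sign_act :: "int \<Rightarrow> 'g::ab_group_add \<Rightarrow> 'g" where
  "sign_act s x = (if s = 1 then x else - x)"

definition tension ::
    "('v, 'e) sgraph \<Rightarrow> ('e \<times> bool \<Rightarrow> int) \<Rightarrow> ('e \<Rightarrow> 'g::ab_group_add) \<Rightarrow> bool" where
  "tension S \<omega> f \<longleftrightarrow> (\<forall>hs. circuit_walk S hs \<longrightarrow>
     (\<Sum>i<length hs. sign_act (\<omega> (hs ! i) * (\<Prod>j<i. esign S (fst (hs ! j)))) (f (fst (hs ! i)))) = 0)"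

definition doubles :: "'g::ab_group_add set" where
  "doubles = {x + x | x. True}"

definition potential_difference ::
    "('v, 'e) sgraph \<Rightarrow> ('e \<times> bool \<Rightarrow> int) \<Rightarrow> ('e \<Rightarrow> 'g::ab_group_add) \<Rightarrow> bool" where
  "potential_difference S \<omega> f \<longleftrightarrow> tension S \<omega> f \<and>
     (\<forall>hs. cycle_walk S hs \<and> unbalanced_cycle S (edges_of hs) \<longrightarrow>
        (\<Sum>i<length hs. f (fst (hs ! i))) \<in> doubles)"

text \<open>
  Functions on the edge set are taken extensional, so that each map \<open>E \<rightarrow> G\<close> is counted once.
\<close>

definition tensions ::
    "('v, 'e) sgraph \<Rightarrow> ('e \<times> bool \<Rightarrow> int) \<Rightarrow> ('e \<Rightarrow> 'g::ab_group_add) set" where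
  "tensions S \<omega> = {f \<in> edges S \<rightarrow>\<^sub>E UNIV. tension S \<omega> f}"

definition potential_differences ::
    "('v, 'e) sgraph \<Rightarrow> ('e \<times> bool \<Rightarrow> int) \<Rightarrow> ('e \<Rightarrow> 'g::ab_group_add) set" where
  "potential_differences S \<omega> = {f \<in> edges S \<rightarrow>\<^sub>E UNIV. potential_difference S \<omega> f}"

end

theory Submission imports Defs begin

text \<open>
  Give every walk its sign and its value, the signed sum in the definition of a tension. The pair
  (value, sign) is multiplicative in the semidirect product of \<open>G\<close> with \<open>{-1, 1}\<close>, where every
  element of sign \<open>-1\<close> is an involution. A tension is exactly a function for which every closed
  walk of sign \<open>1\<close> has value \<open>0\<close>: a shortest closed walk violating this is a balanced cycle or has
  the form \<open>B P D P\<^sup>-\<^sup>1\<close> with negative simple closed walks \<open>B\<close>, \<open>D\<close>, and any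
  intersection among \<open>B\<close>, \<open>P\<close>, \<open>D\<close> beyond those of a handcuff expresses its value by shorter walks.

  Hence, with a root in each component and a walk from the root to each vertex, a tension is
  determined by the values of these walks and, for each unbalanced component, by the common value
  of the negative closed walks at its root; all these values can be prescribed freely. Signs
  disappear modulo \<open>2G\<close>, so a tension is a potential difference iff the values of the
  negative closed walks lie in \<open>2G\<close>.
\<close>

section \<open>Signs, values and reversal of walks\<close>

lemma sign_act_simps [simp]:
  "sign_act 1 x = x" "sign_act (-1) x = - x" "sign_act s 0 = 0"
  "sign_act s (- x) = - sign_act s x"
  by (simp_all add: sign_act_def)

lemma sign_act_add: "sign_act s (x + y) = sign_act s x + sign_act s y"
  by (simp add: sign_act_def)

lemma sign_act_mult:
  "s \<in> {-1, 1} \<Longrightarrow> t \<in> {-1, 1} \<Longrightarrow> sign_act (s * t) x = sign_act s (sign_act t x)"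
  by (auto simp: sign_act_def)

definition walk_sign :: "('v, 'e) sgraph \<Rightarrow> ('e \<times> bool) list \<Rightarrow> int" where
  "walk_sign S hs = (\<Prod>h\<leftarrow>hs. esign S (fst h))"

text \<open>Horner form of the signed sum in \<open>tension\<close>: the sign of the first edge is
  factored out of everything after it, so that concatenation becomes the semidirect product
  rule.\<close>

fun walk_val ::
    "('v, 'e) sgraph \<Rightarrow> ('e \<times> bool \<Rightarrow> int) \<Rightarrow> ('e \<Rightarrow> 'g::ab_group_add) \<Rightarrow> ('e \<times> bool) list \<Rightarrow> 'g"
where
  "walk_val S \<omega> f [] = 0"
| "walk_val S \<omega> f (h # hs) =
     sign_act (\<omega> h) (f (fst h)) + sign_act (esign S (fst h)) (walk_val S \<omega> f hs)"

definition flip :: "'e \<times> bool \<Rightarrow> 'e \<times> bool" where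
  "flip h = (fst h, \<not> snd h)"

definition reverse_walk :: "('e \<times> bool) list \<Rightarrow> ('e \<times> bool) list" where
  "reverse_walk hs = rev (map flip hs)"

lemma flip_simps [simp]:
  "fst (flip h) = fst h" "leaves S (flip h) = arrives S h" "arrives S (flip h) = leaves S h"
  by (simp_all add: flip_def leaves_def arrives_def)

lemma same_edge_cases: "fst h = fst k \<Longrightarrow> k = h \<or> k = flip h"
  by (cases h; cases k) (auto simp: flip_def)

lemma reverse_walk_simps [simp]:
  "reverse_walk [] = []" "reverse_walk (h # hs) = reverse_walk hs @ [flip h]"
  "length (reverse_walk hs) = length hs" "edges_of (reverse_walk hs) = edges_of hs"
  by (auto simp: reverse_walk_def edges_of_def image_image)

lemma map_fst_reverse_walk: "map fst (reverse_walk hs) = rev (map fst hs)"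
  by (simp add: reverse_walk_def rev_map comp_def)

lemma edges_of_simps [simp]:
  "edges_of [] = {}" "edges_of (h # hs) = insert (fst h) (edges_of hs)"
  "edges_of (hs @ ks) = edges_of hs \<union> edges_of ks"
  by (auto simp: edges_of_def)

lemma walk_sign_simps [simp]:
  "walk_sign S [] = 1" "walk_sign S (h # hs) = esign S (fst h) * walk_sign S hs"
  "walk_sign S (hs @ ks) = walk_sign S hs * walk_sign S ks"
  by (simp_all add: walk_sign_def)

lemma walk_sign_reverse [simp]: "walk_sign S (reverse_walk hs) = walk_sign S hs"
  by (induction hs) auto

lemma edge_verts_edges_of:
  fixes S :: "('v, 'e) sgraph"
  shows "edge_verts S (edges_of hs) = leaves S ` set hs \<union> arrives S ` set hs"
proof -
  have *: "range g = {g b, g (\<not> b)}" for g :: "bool \<Rightarrow> 'v" and b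
    by (cases b) (auto simp: UNIV_bool)
  have "range (\<lambda>b. endpoint S (fst h, b)) = {leaves S h, arrives S h}" for h
    using *[of "\<lambda>b. endpoint S (fst h, b)" "snd h"] by (simp add: leaves_def arrives_def)
  moreover have
    "edge_verts S (edges_of hs) = (\<Union>h\<in>set hs. range (\<lambda>b. endpoint S (fst h, b)))"
    by (auto simp: edge_verts_def edges_of_def)
  ultimately show ?thesis
    by auto
qed

section \<open>The subgroup 2G\<close>

lemma double_in_doubles: "x + x \<in> doubles"
  by (auto simp: doubles_def)

lemma doubles_add: "x \<in> doubles \<Longrightarrow> y \<in> doubles \<Longrightarrow> x + y \<in> doubles"
proof -
  assume "x \<in> doubles" "y \<in> doubles"
  then obtain a b where "x = a + a" "y = b + b"
    by (auto simp: doubles_def)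
  then have "x + y = (a + b) + (a + b)"
    by (simp add: algebra_simps)
  then show ?thesis
    by (auto simp: doubles_def)
qed

lemma doubles_minus: "x \<in> doubles \<Longrightarrow> - x \<in> doubles"
  by (auto simp: doubles_def intro: minus_add_distrib)

lemma double_add_doubles_iff: "(x + x) + y \<in> doubles \<longleftrightarrow> y \<in> doubles"
  using doubles_add[OF double_in_doubles, of y x]
    doubles_add[OF doubles_minus[OF double_in_doubles], of "(x + x) + y" x] by auto

lemma doubles_diff_iff: "x - y \<in> doubles \<Longrightarrow> y \<in> doubles \<longleftrightarrow> x \<in> doubles"
  using doubles_add[of "x - y" y] doubles_add[of "- (x - y)" x] doubles_minus[of "x - y"] by auto

lemma sign_act_doubles_iff: "sign_act s x \<in> doubles \<longleftrightarrow> x \<in> doubles"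
  using doubles_minus[of x] doubles_minus[of "- x"] by (auto simp: sign_act_def)

lemma sign_act_diff_doubles:
  fixes x :: "'a::ab_group_add"
  shows "sign_act s x - x \<in> doubles"
  using double_in_doubles[of "0 :: 'a"] double_in_doubles[of "- x"] by (simp add: sign_act_def)

text \<open>Since x and -x differ by x + x, signs are invisible modulo 2G. This links the unsigned
  sums in \<open>potential_difference\<close> to walk values.\<close>

lemma walk_val_minus_sum_doubles:
  "walk_val S \<omega> f hs - (\<Sum>h\<leftarrow>hs. f (fst h)) \<in> doubles"
proof (induction hs)
  case (Cons h hs)
  have "walk_val S \<omega> f (h # hs) - (\<Sum>h\<leftarrow>h # hs. f (fst h)) =
    (sign_act (\<omega> h) (f (fst h)) - f (fst h)) +
    ((sign_act (esign S (fst h)) (walk_val S \<omega> f hs) - walk_val S \<omega> f hs) +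
     (walk_val S \<omega> f hs - (\<Sum>h\<leftarrow>hs. f (fst h))))"
    by (simp add: algebra_simps)
  also have "\<dots> \<in> doubles"
    using Cons.IH by (intro doubles_add sign_act_diff_doubles)
  finally show ?case .
qed (use double_in_doubles[of 0] in simp)

section \<open>Walks in an oriented signed graph\<close>

locale oriented_signed_graph =
  fixes S :: "('v, 'e) sgraph" and \<omega> :: "'e \<times> bool \<Rightarrow> int"
  assumes signed_graph: "signed_graph S" and orientation: "compatible_orientation S \<omega>"
begin

lemma esign_cases: "e \<in> edges S \<Longrightarrow> esign S e \<in> {-1, 1}"
  using signed_graph by (auto simp: signed_graph_def)

lemma orient_cases: "fst h \<in> edges S \<Longrightarrow> \<omega> h \<in> {-1, 1}"
  using orientation by (cases h) (auto simp: compatible_orientation_def)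

text \<open>Compatibility solved for the other half-edge. It makes going along an edge and straight
  back have value 0.\<close>

lemma orient_flip: "fst h \<in> edges S \<Longrightarrow> \<omega> (flip h) = - (esign S (fst h) * \<omega> h)"
proof -
  assume "fst h \<in> edges S"
  then have "\<omega> (fst h, True) \<in> {-1, 1}" "\<omega> (fst h, False) \<in> {-1, 1}"
    "esign S (fst h) = - (\<omega> (fst h, True) * \<omega> (fst h, False))"
    using orientation by (auto simp: compatible_orientation_def)
  then show ?thesis by (cases h; cases "snd h") (auto simp: flip_def)
qed

lemma arrives_in_verts: "fst h \<in> edges S \<Longrightarrow> arrives S h \<in> verts S"
  and leaves_in_verts: "fst h \<in> edges S \<Longrightarrow> leaves S h \<in> verts S"
  using signed_graph by (cases h; auto simp: signed_graph_def arrives_def leaves_def)+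

lemma walk_in_verts: "walk S u hs v \<Longrightarrow> u \<in> verts S \<and> v \<in> verts S"
  by (induction hs arbitrary: u) (auto simp: leaves_in_verts)

lemma walk_edges: "walk S u hs v \<Longrightarrow> edges_of hs \<subseteq> edges S"
  by (induction hs arbitrary: u) auto

lemma walk_append: "walk S u (hs @ ks) v \<longleftrightarrow> (\<exists>w. walk S u hs w \<and> walk S w ks v)"
  by (induction hs arbitrary: u) (auto dest: walk_in_verts)

lemma walk_appendI [intro]: "walk S u hs w \<Longrightarrow> walk S w ks v \<Longrightarrow> walk S u (hs @ ks) v"
  by (auto simp: walk_append)

lemma walk_reverse: "walk S u hs v \<Longrightarrow> walk S v (reverse_walk hs) u"
  by (induction hs arbitrary: u) (auto simp: walk_append leaves_in_verts)

lemma walk_sign_cases: "edges_of hs \<subseteq> edges S \<Longrightarrow> walk_sign S hs \<in> {-1, 1}"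
  by (induction hs) (use esign_cases in force)+

lemma walk_val_append:
  "edges_of hs \<subseteq> edges S \<Longrightarrow> edges_of ks \<subseteq> edges S \<Longrightarrow>
   walk_val S \<omega> f (hs @ ks) = walk_val S \<omega> f hs + sign_act (walk_sign S hs) (walk_val S \<omega> f ks)"
proof (induction hs)
  case (Cons h hs)
  have "walk_sign S hs \<in> {-1, 1}"
    using Cons.prems by (intro walk_sign_cases) simp
  then show ?case
    using Cons esign_cases[of "fst h"]
    by (simp add: sign_act_mult sign_act_add add.assoc del: insert_iff)
qed simp

text \<open>The inverse in the semidirect product, where (x, s) has inverse (- s x, s).\<close>

lemma walk_val_reverse:
  "edges_of hs \<subseteq> edges S \<Longrightarrow>
   walk_val S \<omega> f (reverse_walk hs) = - sign_act (walk_sign S hs) (walk_val S \<omega> f hs)"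
proof (induction hs)
  case (Cons h hs)
  have "walk_sign S hs \<in> {-1, 1}"
    using Cons.prems by (intro walk_sign_cases) simp
  moreover have "esign S (fst h) \<in> {-1, 1}" "\<omega> h \<in> {-1, 1}"
    using Cons.prems esign_cases orient_cases by auto
  ultimately show ?case
    using Cons orient_flip[of h] by (auto simp: walk_val_append)
qed simp

lemma walk_val_eq_sum:
  "edges_of hs \<subseteq> edges S \<Longrightarrow>
   (\<Sum>i<length hs. sign_act (\<omega> (hs ! i) * (\<Prod>j<i. esign S (fst (hs ! j)))) (f (fst (hs ! i))))
     = walk_val S \<omega> f hs"
\<comment> \<open>Appending at the end keeps all earlier prefix products and gives the new summand
  the sign of the whole old walk.\<close>
proof (induction hs rule: rev_induct)
  case (snoc h hs)
  have "(\<Prod>j<length hs. esign S (fst ((hs @ [h]) ! j))) = walk_sign S hs"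
    by (simp add: walk_sign_def prod.list_conv_set_nth nth_append atLeast0LessThan)
  moreover have "(\<Prod>j<i. esign S (fst ((hs @ [h]) ! j))) = (\<Prod>j<i. esign S (fst (hs ! j)))"
    if "i < length hs" for i
    using that by (intro prod.cong) (auto simp: nth_append)
  ultimately show ?case
    using snoc walk_sign_cases[of hs] orient_cases[of h]
    by (simp add: nth_append walk_val_append mult.commute[of "\<omega> _"] sign_act_mult del: insert_iff)
qed simp

subsection \<open>Closed walks and cycles\<close>

lemma walk_split_leaves:
  assumes "walk S u hs v" "z \<in> leaves S ` set hs"
  obtains A B where "hs = A @ B" "walk S u A z" "walk S z B v" "B \<noteq> []"
proof -
  obtain h A B where "hs = A @ h # B" "z = leaves S h"
    using assms(2) by (auto dest: split_list)
  with assms(1) have "walk S u A z" "walk S z (h # B) v"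
    by (auto simp: walk_append)
  with \<open>hs = A @ h # B\<close> show thesis
    using that by blast
qed

lemma walk_split_arrives:
  assumes "walk S u hs v" "z \<in> arrives S ` set hs"
  obtains A B where "hs = A @ B" "walk S u A z" "walk S z B v" "A \<noteq> []"
proof -
  obtain h A B where "hs = A @ h # B" "z = arrives S h"
    using assms(2) by (auto dest: split_list)
  with assms(1) have "walk S u (A @ [h]) z" "walk S z B v"
    by (auto simp: walk_append dest: walk_in_verts)
  with \<open>hs = A @ h # B\<close> show thesis
    using that[of "A @ [h]" B] by simp
qed

text \<open>The stretch between two departures from the same vertex is closed. The second departure
  lies in \<open>C\<close>, so \<open>B\<close> is shorter than \<open>hs\<close>, as the induction
  in \<open>closed_subwalk\<close> requires.\<close>

lemma not_distinct_leaves: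
  assumes "walk S u hs v" "\<not> distinct (map (leaves S) hs)"
  obtains A B C z where "hs = A @ B @ C" "walk S u A z" "walk S z B z" "walk S z C v"
    "B \<noteq> []" "C \<noteq> []"
  using assms
proof (induction hs arbitrary: u thesis)
  case (Cons h hs)
  have u: "leaves S h = u" "u \<in> verts S" and hs: "walk S (arrives S h) hs v"
    using Cons.prems(2) walk_in_verts[OF Cons.prems(2)] by auto
  show ?case
  proof (cases "u \<in> leaves S ` set hs")
    case True
    then obtain A B where "hs = A @ B" "walk S (arrives S h) A u" "walk S u B v" "B \<noteq> []"
      using walk_split_leaves[OF hs] by metis
    then show ?thesis
      using Cons.prems u by (intro Cons.prems(1)[of "[]" "h # A" B u]) auto
  next
    case False
    then have "\<not> distinct (map (leaves S) hs)"
      using Cons.prems u by auto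
    then obtain A B C z where "hs = A @ B @ C" "walk S (arrives S h) A z" "walk S z B z"
      "walk S z C v" "B \<noteq> []" "C \<noteq> []"
      using Cons.IH[OF _ hs] by metis
    then show ?thesis
      using Cons.prems u by (intro Cons.prems(1)[of "h # A" B C z]) auto
  qed
qed simp

lemma not_distinct_arrives:
  assumes "walk S u hs v" "\<not> distinct (u # map (arrives S) hs)"
  obtains A B C z where "hs = A @ B @ C" "walk S u A z" "walk S z B z" "walk S z C v" "B \<noteq> []"
  using assms
proof (induction hs arbitrary: u thesis)
  case (Cons h hs)
  have u: "leaves S h = u" "u \<in> verts S" and hs: "walk S (arrives S h) hs v"
    using Cons.prems(2) walk_in_verts[OF Cons.prems(2)] by auto
  show ?case
  proof (cases "u \<in> arrives S ` set (h # hs)")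
    case True
    then obtain A B where "h # hs = A @ B" "walk S u A u" "walk S u B v" "A \<noteq> []"
      using walk_split_arrives[OF Cons.prems(2)] by metis
    then show ?thesis
      using u by (intro Cons.prems(1)[of "[]" A B u]) auto
  next
    case False
    then have "\<not> distinct (arrives S h # map (arrives S) hs)"
      using Cons.prems u by auto
    then obtain A B C z where "hs = A @ B @ C" "walk S (arrives S h) A z" "walk S z B z"
      "walk S z C v" "B \<noteq> []"
      using Cons.IH[OF _ hs] by metis
    then show ?thesis
      using Cons.prems u by (intro Cons.prems(1)[of "h # A" B C z]) auto
  qed
qed simp

lemma closed_subwalk:
  assumes "walk S v hs v" "hs \<noteq> []"
  shows "\<exists>A B C z. hs = A @ B @ C \<and> walk S v A z \<and> walk S z B z \<and> walk S z C v \<and>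
    B \<noteq> [] \<and> distinct (map (leaves S) B)"
  using assms
proof (induction "length hs" arbitrary: v hs rule: less_induct)
  case less
  show ?case
  proof (cases "distinct (map (leaves S) hs)")
    case True
    then show ?thesis
      using less.prems walk_in_verts[OF less.prems(1)]
      by (intro exI[of _ "[]"] exI[of _ hs] exI[of _ v]) auto
  next
    case False
    then obtain A B C z where *: "hs = A @ B @ C" "walk S v A z" "walk S z B z" "walk S z C v"
      "B \<noteq> []" "C \<noteq> []"
      using not_distinct_leaves[OF less.prems(1)] by metis
    then obtain A' B' C' z' where "B = A' @ B' @ C'" "walk S z A' z'" "walk S z' B' z'"
      "walk S z' C' z" "B' \<noteq> []" "distinct (map (leaves S) B')"
      using less.hyps[of B z] by auto
    with * show ?thesis
      by (intro exI[of _ "A @ A'"] exI[of _ B'] exI[of _ "C' @ C"] exI[of _ z']) auto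
  qed
qed

text \<open>An edge used twice is used once in each direction, since a repeated half-edge would
  repeat a departure. Any step between, after or before the two uses would force a second departure
  from one of its ends.\<close>

lemma closed_walk_distinct_edges:
  assumes "walk S v hs v" "distinct (map (leaves S) hs)"
  shows "distinct (map fst hs) \<or> (\<exists>h. hs = [h, flip h])"
proof (rule disjCI)
  assume no: "\<nexists>h. hs = [h, flip h]"
  show "distinct (map fst hs)"
  proof (rule ccontr)
    assume "\<not> distinct (map fst hs)"
    then obtain A e B C where "map fst hs = A @ [e] @ B @ [e] @ C"
      using not_distinct_decomp by blast
    then obtain X h M k Y where hs: "hs = X @ h # M @ k # Y" "fst h = fst k"
      by (auto simp: map_eq_append_conv append_eq_map_conv Cons_eq_map_conv)
    then have "k \<noteq> h"
      using assms(2) by auto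
    then have k: "k = flip h"
      using hs same_edge_cases by metis
    obtain u where u: "walk S v X u" "walk S u (h # M @ flip h # Y) v"
      using assms(1) hs k by (auto simp only: walk_append)
    have d: "distinct (map (leaves S) X @ leaves S h # map (leaves S) M @ arrives S h # map (leaves S) Y)"
      using assms(2) hs k by simp
    have "M = []"
    proof (cases M)
      case (Cons m M')
      then have "leaves S m = arrives S h"
        using u by simp
      then show ?thesis
        using d Cons by simp
    qed
    moreover have "Y = []"
    proof (cases Y)
      case (Cons m M')
      then have "leaves S m = leaves S h"
        using u \<open>M = []\<close> by simp
      then show ?thesis
        using d Cons by simp
    qed
    moreover have "X = []"
    proof (cases X)
      case (Cons m M')
      then have "leaves S m = leaves S h"
        using u \<open>M = []\<close> \<open>Y = []\<close> by auto
      then show ?thesis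
        using d Cons by simp
    qed
    ultimately show False
      using no hs k by auto
  qed
qed

lemma closed_walk_iff: "closed_walk S hs \<longleftrightarrow> hs \<noteq> [] \<and> (\<exists>v. walk S v hs v)"
  by (cases hs) (auto simp: closed_walk_def)

text \<open>Both sides are the set of visited vertices, so it can be read off from departures or
  from arrivals.\<close>

lemma insert_arrives_eq:
  "walk S u hs v \<Longrightarrow> insert u (arrives S ` set hs) = insert v (leaves S ` set hs)"
  by (induction hs arbitrary: u) auto

lemma walk_last: "walk S u hs v \<Longrightarrow> hs \<noteq> [] \<Longrightarrow> arrives S (last hs) = v"
  by (induction hs arbitrary: u) auto

lemma edge_verts_closed:
  assumes "walk S v hs v" "hs \<noteq> []"
  shows "edge_verts S (edges_of hs) = leaves S ` set hs" "v \<in> leaves S ` set hs"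
proof -
  show v: "v \<in> leaves S ` set hs"
    using assms by (cases hs) auto
  then show "edge_verts S (edges_of hs) = leaves S ` set hs"
    using insert_arrives_eq[OF assms(1)] by (auto simp: edge_verts_edges_of)
qed

lemma prod_edges_of: "distinct (map fst hs) \<Longrightarrow> (\<Prod>e\<in>edges_of hs. esign S e) = walk_sign S hs"
  using prod.distinct_set_conv_list[of "map fst hs" "esign S"]
  by (simp add: edges_of_def walk_sign_def comp_def)

text \<open>The exceptional walk \<open>[h, flip h]\<close> has sign 1, so a negative sign rules it
  out.\<close>

lemma negative_simple_closed_walk:
  assumes "walk S v hs v" "hs \<noteq> []" "distinct (map (leaves S) hs)" "walk_sign S hs = -1"
  shows "cycle_walk S hs" "unbalanced_cycle S (edges_of hs)"
proof -
  have "fst h \<in> edges S \<Longrightarrow> esign S (fst h) * esign S (fst h) = 1" for h :: "'e \<times> bool"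
    using esign_cases[of "fst h"] by auto
  then have "distinct (map fst hs)"
    using closed_walk_distinct_edges[OF assms(1,3)] assms(1,4) by auto
  then show "cycle_walk S hs" "unbalanced_cycle S (edges_of hs)"
    using assms by (auto simp: cycle_walk_def closed_walk_iff unbalanced_cycle_def cycle_def prod_edges_of)
qed

lemma cycle_walk_loop:
  assumes "cycle_walk S hs" "h \<in> set hs" "leaves S h = arrives S h"
  shows "hs = [h]"
proof -
  obtain v where v: "walk S v hs v" and d: "distinct (map (leaves S) hs)"
    using assms(1) by (auto simp: cycle_walk_def closed_walk_iff)
  obtain X Y where hs: "hs = X @ h # Y"
    using assms(2) by (auto dest: split_list)
  then have "Y = []"
    using v d assms(3) by (cases Y) (auto simp: walk_append)
  moreover from this have "X = []"
    using hs v d assms(3) by (cases X) (auto simp: walk_append)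
  ultimately show ?thesis
    using hs by simp
qed

lemma endpoints_in_edge_verts:
  "fst h \<in> C \<Longrightarrow> leaves S h \<in> edge_verts S C \<and> arrives S h \<in> edge_verts S C"
  by (cases h) (force simp: edge_verts_def leaves_def arrives_def)

text \<open>A common edge has both ends at the only common vertex, so it is a loop, and a loop is
  all of any cycle through it.\<close>

lemma tight_handcuff_disjoint:
  assumes "cycle S C1" "cycle S C2" "C1 \<noteq> C2" "edge_verts S C1 \<inter> edge_verts S C2 \<subseteq> {v}"
  shows "C1 \<inter> C2 = {}"
proof (rule ccontr)
  assume "C1 \<inter> C2 \<noteq> {}"
  then obtain e where e: "e \<in> C1" "e \<in> C2"
    by auto
  have "leaves S h = v \<and> arrives S h = v" if "fst h = e" for h
    using that e endpoints_in_edge_verts[of h] assms(4) by blast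
  then have "C = {e}" if "cycle S C" "e \<in> C" for C
    using that cycle_walk_loop by (fastforce simp: cycle_def edges_of_def)
  then show False
    using assms(1-3) e by blast
qed

lemma path_no_loop:
  assumes "path S u hs v" "h \<in> set hs"
  shows "leaves S h \<noteq> arrives S h"
proof -
  obtain X Y where hs: "hs = X @ h # Y"
    using assms(2) by (auto dest: split_list)
  then show ?thesis
    using assms(1) by (cases X rule: rev_cases) (auto simp: path_def walk_append)
qed

lemma path_distinct_edges: "path S u hs v \<Longrightarrow> distinct (map fst hs)"
proof (induction hs arbitrary: u)
  case (Cons h hs)
  have "fst k \<noteq> fst h" if "k \<in> set hs" for k
  proof
    assume "fst k = fst h"
    then have "k = h \<or> k = flip h"
      using same_edge_cases by metis
    then show False
      using that Cons.prems by (auto simp: path_def) (metis flip_simps(3) image_eqI)+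
  qed
  moreover have "distinct (map fst hs)"
    using Cons by (auto simp: path_def)
  ultimately show ?case
    by fastforce
qed simp

text \<open>An edge of the path in \<open>C\<close> would have both ends at \<open>z\<close>, but a
  path contains no loop.\<close>

lemma path_disjoint:
  assumes "path S u hs v" "set (u # map (arrives S) hs) \<inter> edge_verts S C = {z}"
  shows "edges_of hs \<inter> C = {}"
proof -
  have False if "h \<in> set hs" "fst h \<in> C" for h
  proof -
    have "insert u (arrives S ` set hs) = insert v (leaves S ` set hs)"
      using assms(1) insert_arrives_eq by (auto simp: path_def)
    then have "leaves S h = z" "arrives S h = z"
      using that assms(2) endpoints_in_edge_verts[of h C] by auto
    then show False
      using path_no_loop[OF assms(1) that(1)] by simp
  qed
  then show ?thesis
    by (auto simp: edges_of_def)
qed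

lemma count_list_distinct: "distinct xs \<Longrightarrow> count_list xs x = (if x \<in> set xs then 1 else 0)"
  by (induction xs) auto

subsection \<open>Tensions vanish on positive closed walks\<close>

lemma tension_circuit_walk:
  assumes "tension S \<omega> f" "circuit_walk S hs"
  shows "walk_val S \<omega> f hs = 0"
proof -
  have "edges_of hs \<subseteq> edges S"
    using assms(2) walk_edges by (auto simp: circuit_walk_def closed_walk_iff)
  then show ?thesis
    using assms by (simp add: tension_def flip: walk_val_eq_sum)
qed

text \<open>As \<open>B\<close> is negative, the claim says that the closed walk B P D P^-1 has
  value 0, and \<open>short\<close> is the induction hypothesis for shorter walks. A handcuff makes
  it a circuit walk; an extra intersection lets the equation be assembled from shorter
  walks.\<close>

lemma handcuff_val:
  fixes f :: "'e \<Rightarrow> 'g::ab_group_add"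
  assumes f: "tension S \<omega> f"
    and B: "walk S y B y" "B \<noteq> []" "distinct (map (leaves S) B)" "walk_sign S B = -1"
    and D: "walk S x D x" "D \<noteq> []" "distinct (map (leaves S) D)" "walk_sign S D = -1"
    and P: "walk S y P x"
    and short: "\<And>v hs. walk S v hs v \<Longrightarrow> walk_sign S hs = 1 \<Longrightarrow>
      length hs < length B + length D + 2 * length P \<Longrightarrow> walk_val S \<omega> f hs = 0"
  shows "walk_val S \<omega> f B = walk_val S \<omega> f (P @ D @ reverse_walk P)"
proof -
  let ?val = "walk_val S \<omega> f" and ?sgn = "walk_sign S"
  note val = walk_val_append walk_val_reverse
  \<comment> \<open>Closing \<open>A\<close> by the reverse of \<open>C\<close> gives a positive
    walk of value \<open>?val A - ?val C\<close>.\<close>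
  have parallel: "?val A = ?val C"
    if "walk S u A v" "walk S u C v" "?sgn A = ?sgn C" "length A + length C < length B + length D + 2 * length P" for u v A C
  proof -
    have "?val (A @ reverse_walk C) = 0"
      using that walk_sign_cases[OF walk_edges[OF that(2)]]
      by (intro short[of u]) (auto intro: walk_reverse)
    then show ?thesis
      using that(3) that(1,2)[THEN walk_edges] walk_sign_cases[OF walk_edges[OF that(2)]]
      by (auto simp: val)
  qed
  \<comment> \<open>If \<open>P\<close> meets \<open>B\<close> at \<open>z\<close>, its part before \<open>z\<close> is parallel, with equal sign, to one of the two arcs of \<open>B\<close>.\<close>
  have meet: "?val B = ?val (P @ D @ reverse_walk P)"
    if par: "\<And>u A v C. walk S u A v \<Longrightarrow> walk S u C v \<Longrightarrow> ?sgn A = ?sgn C \<Longrightarrow>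
        length A + length C < length B + length D + 2 * length P \<Longrightarrow> ?val A = ?val C"
      and that': "walk S y B y" "?sgn B = -1" "walk S x D x" "?sgn D = -1" "walk S y P x"
      "z \<in> leaves S ` set B" "z \<in> arrives S ` set P" "z \<noteq> y" for x y z B D P
  proof -
    obtain B1 B2 where B12: "B = B1 @ B2" "walk S y B1 z" "walk S z B2 y"
      using walk_split_leaves that'(1,6) by metis
    obtain P1 P2 where P12: "P = P1 @ P2" "walk S y P1 z" "walk S z P2 x" "P1 \<noteq> []"
      using walk_split_arrives that'(5,7) by metis
    have sgn: "?sgn B1 \<in> {-1, 1}" "?sgn B2 \<in> {-1, 1}" "?sgn P1 \<in> {-1, 1}" "?sgn P2 \<in> {-1, 1}"
      using B12 P12 walk_edges walk_sign_cases by metis+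
    \<comment> \<open>The signs agree because \<open>B\<close> and \<open>D\<close> are both
      negative. The total length falls below the bound by twice the length of \<open>P1\<close>,
      which is nonempty.\<close>
    have "?val B2 = ?val (P2 @ D @ reverse_walk P2 @ reverse_walk B1)"
      using B12 P12 that' sgn by (intro par[of z _ y]) (auto intro!: walk_reverse)
    moreover have "?val P1 = ?val B1" if "?sgn P1 = ?sgn B1"
      using that B12 P12 by (intro par[of y _ z]) auto
    moreover have "?val P1 = ?val (reverse_walk B2)" if "?sgn P1 = ?sgn B2"
      using that B12 P12 by (intro par[of y _ z]) (auto intro: walk_reverse)
    ultimately show ?thesis
      using sgn B12(1) P12(1) that'(2,4) B12(2,3)[THEN walk_edges] P12(2,3)[THEN walk_edges]
        walk_edges[OF that'(3)]
      by (auto simp: val) (simp_all (no_asm) add: algebra_simps)?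
  qed
  \<comment> \<open>Conjugation by \<open>P\<close> exchanges the two cycles, so the case where
    \<open>P\<close> meets \<open>D\<close> reduces to \<open>meet\<close>.\<close>
  have symmetric: "?val B = ?val (P @ D @ reverse_walk P)"
    if "?val D = ?val (reverse_walk P @ B @ reverse_walk (reverse_walk P))"
    using that B(4) D(4) walk_sign_cases[OF walk_edges[OF P]] walk_edges[OF P]
      walk_edges[OF B(1)] walk_edges[OF D(1)]
    by (auto simp: val) (simp_all (no_asm) add: algebra_simps)?
  \<comment> \<open>\<open>arrives\<close> lists the vertices of \<open>P\<close> after its start
    and \<open>leaves\<close> those before its end; the start and the end are where \<open>P\<close>
    may touch \<open>B\<close> and \<open>D\<close>.\<close>
  consider
      (path) "\<not> distinct (y # map (arrives S) P)"
    | (meets_B) z where "z \<in> leaves S ` set B" "z \<in> arrives S ` set P" "z \<noteq> y"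
    | (meets_D) z where "z \<in> leaves S ` set D" "z \<in> leaves S ` set P" "z \<noteq> x"
    | (BD) z where "z \<in> leaves S ` set B" "z \<in> leaves S ` set D" "z \<noteq> x" "z \<noteq> y"
    | (disjoint) "distinct (y # map (arrives S) P)"
        "leaves S ` set B \<inter> arrives S ` set P \<subseteq> {y}"
        "leaves S ` set D \<inter> leaves S ` set P \<subseteq> {x}"
        "leaves S ` set B \<inter> leaves S ` set D \<subseteq> {x, y}"
    by blast
  then show ?thesis
  proof cases
    case path
    then obtain P1 P2 P3 z where P123: "P = P1 @ P2 @ P3" "walk S y P1 z" "walk S z P2 z"
      "walk S z P3 x" "P2 \<noteq> []"
      using not_distinct_arrives[OF P] by metis
    note edges = P123(2-4)[THEN walk_edges] walk_edges[OF D(1)]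
    note sgn = edges[THEN walk_sign_cases]
    \<comment> \<open>\<open>P2\<close> is a closed detour of \<open>P\<close>. A positive one has
      value 0 and is cut out; a negative one is compared with \<open>B\<close> along
      \<open>P1\<close> and with \<open>D\<close> along \<open>P3\<close>.\<close>
    show ?thesis
    proof (cases "?sgn P2 = 1")
      case True
      then have "?val P2 = 0"
        using P123 B by (intro short[of z]) auto
      moreover have "?val B = ?val ((P1 @ P3) @ D @ reverse_walk (P1 @ P3))"
        using P123 B D sgn by (intro parallel[of y _ y]) (auto intro!: walk_reverse walk_appendI)
      ultimately show ?thesis
        using P123(1) True sgn D(4) edges by (auto simp: val) (simp_all (no_asm) add: algebra_simps)?
    next
      case False
      then have "?sgn P2 = -1"
        using sgn by auto
      moreover have "?val B = ?val (P1 @ P2 @ reverse_walk P1)"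
        using P123 B D sgn \<open>?sgn P2 = -1\<close>
        by (intro parallel[of y _ y]) (auto intro!: walk_reverse walk_appendI)
      moreover have "?val P2 = ?val (P3 @ D @ reverse_walk P3)"
        using P123 B D sgn \<open>?sgn P2 = -1\<close>
        by (intro parallel[of z _ z]) (auto intro!: walk_reverse walk_appendI)
      ultimately show ?thesis
        using P123(1) sgn D(4) edges by (auto simp: val) (simp_all (no_asm) add: algebra_simps)?
    qed
  next
    case (meets_B z)
    show ?thesis
      by (rule meet[OF parallel _ _ _ _ _ meets_B]) (use assms in auto)
  next
    case (meets_D z)
    then have "z \<in> arrives S ` set (reverse_walk P)"
      by (auto simp: reverse_walk_def image_image)
    then show ?thesis
      by (intro symmetric meet[OF parallel, where y = x and z = z])
        (use assms meets_D in \<open>auto intro: walk_reverse\<close>)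
  next
    case (BD z)
    obtain B1 B2 where B12: "B = B1 @ B2" "walk S y B1 z" "walk S z B2 y"
      using walk_split_leaves B(1) BD(1) by metis
    obtain D1 D2 where D12: "D = D1 @ D2" "walk S x D1 z" "walk S z D2 x"
      using walk_split_leaves D(1) BD(2) by metis
    note edges = B12(2,3)[THEN walk_edges] D12(2,3)[THEN walk_edges] walk_edges[OF P]
    note sgn = edges[THEN walk_sign_cases]
    have ne: "B1 \<noteq> []" "B2 \<noteq> []" "D1 \<noteq> []" "D2 \<noteq> []"
      using B12 D12 BD by auto
    \<comment> \<open>The two arcs of \<open>B\<close> have opposite signs, and so do those of
      \<open>D\<close>. Hence the arcs of \<open>B\<close> match those of \<open>D\<close> either
      both forwards or both reversed, and \<open>B\<close> has the value of P D P^-1 or of P D^-1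
      P^-1; these agree as \<open>D\<close> is negative.\<close>
    have "?val B1 = ?val (P @ D1)" if "?sgn B1 = ?sgn (P @ D1)"
      using that B12 D12 P ne by (intro parallel[of y _ z]) auto
    moreover have "?val B2 = ?val (D2 @ reverse_walk P)" if "?sgn B2 = ?sgn (D2 @ P)"
      using that B12 D12 P ne by (intro parallel[of z _ y]) (auto intro: walk_reverse)
    moreover have "?val B1 = ?val (P @ reverse_walk D2)" if "?sgn B1 = ?sgn (P @ D2)"
      using that B12 D12 P ne by (intro parallel[of y _ z]) (auto intro: walk_reverse)
    moreover have "?val B2 = ?val (reverse_walk D1 @ reverse_walk P)" if "?sgn B2 = ?sgn (D1 @ P)"
      using that B12 D12 P ne by (intro parallel[of z _ y]) (auto intro: walk_reverse)
    ultimately show ?thesis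
      using sgn edges B12(1) D12(1) B(4) D(4) by (auto simp: val) (simp_all (no_asm) add: algebra_simps)?
  next
    case disjoint
    let ?W = "B @ P @ D @ reverse_walk P"
    note cB = negative_simple_closed_walk[OF B] and cD = negative_simple_closed_walk[OF D]
    note vB = edge_verts_closed[OF B(1,2)] and vD = edge_verts_closed[OF D(1,2)]
    have path: "path S y P x"
      using P disjoint(1) by (simp add: path_def)
    have count: "count_list (map fst B) e = (if e \<in> edges_of B then 1 else 0)"
      "count_list (map fst D) e = (if e \<in> edges_of D then 1 else 0)"
      "count_list (map fst P) e = (if e \<in> edges_of P then 1 else 0)" for e
      using cB cD path_distinct_edges[OF path]
      by (auto simp: cycle_walk_def count_list_distinct edges_of_def)
    have closed: "closed_walk S ?W"
      using B D P by (auto simp: closed_walk_iff intro!: exI[of _ y] walk_reverse walk_appendI)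
    \<comment> \<open>The exception is a single loop serving as both \<open>B\<close> and
      \<open>D\<close>: it meets itself in just one vertex but is no handcuff.\<close>
    have "circuit_walk S ?W \<or> (\<exists>h k. B = [h] \<and> D = [k] \<and> P = [] \<and> fst h = fst k)"
    proof (cases "P = []")
      case True
      then have "x = y"
        using P by simp
      then have *: "edge_verts S (edges_of B) \<inter> edge_verts S (edges_of D) = {y}"
        using disjoint vB vD by auto
      show ?thesis
      proof (cases "edges_of B = edges_of D")
        case True
        then have "leaves S ` set B = {y}" "leaves S ` set D = {y}"
          using * vB vD by auto
        then have "length B = 1" "length D = 1"
          using B(3) D(3) by (metis distinct_card length_map list.set_map card.empty card.insert
            empty_iff finite.emptyI One_nat_def)+
        then show ?thesis
          using True \<open>P = []\<close> by (auto simp: length_Suc_conv)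
      next
        case False
        then have "circuit S (edges_of B \<union> edges_of D) {}"
          using cB cD * by (intro tight_handcuff)
        moreover have "edges_of B \<inter> edges_of D = {}"
          using False cB cD * by (intro tight_handcuff_disjoint) (auto simp: unbalanced_cycle_def)
        ultimately show ?thesis
          using closed count \<open>P = []\<close>
          by (intro disjI1) (auto simp: circuit_walk_def intro!: exI[of _ "edges_of B \<union> edges_of D"]
            exI[of _ "{}"])
      qed
    next
      case False
      then have "x \<in> arrives S ` set P" "leaves S (hd P) = y"
        using walk_last[OF P] P last_in_set by (blast, cases P, simp_all)
      then have ends: "x \<in> arrives S ` set P" "y \<in> leaves S ` set P" "x \<noteq> y"
        using disjoint(1) hd_in_set[OF False] by (blast, blast, simp, blast)
      have *: "set (y # map (arrives S) P) \<inter> edge_verts S (edges_of B) = {y}"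
        using disjoint(2) vB by auto
      have "set (y # map (arrives S) P) = insert x (leaves S ` set P)"
        using insert_arrives_eq[OF P] by simp
      then have **: "set (y # map (arrives S) P) \<inter> edge_verts S (edges_of D) = {x}"
        using disjoint(3) vD by auto
      have "x \<notin> leaves S ` set B" "y \<notin> leaves S ` set D"
        using ends subsetD[OF disjoint(2), of x] subsetD[OF disjoint(3), of y] by (simp, satx)+
      then have ***: "edge_verts S (edges_of B) \<inter> edge_verts S (edges_of D) = {}"
        unfolding vB(1) vD(1) using subsetD[OF disjoint(4)] by auto
      then have "circuit S (edges_of B \<union> edges_of D \<union> edges_of P) (edges_of P)"
        using cB cD path * ** by (intro loose_handcuff)
      moreover have "edges_of P \<inter> edges_of B = {}" "edges_of P \<inter> edges_of D = {}"
        using path_disjoint[OF path *] path_disjoint[OF path **] by auto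
      moreover have "edges_of B \<inter> edges_of D = {}"
        using *** by (auto simp: edge_verts_def)
      ultimately show ?thesis
        using closed count
        by (intro disjI1) (auto simp: circuit_walk_def map_fst_reverse_walk Un_ac
          intro!: exI[of _ "edges_of P"])
    qed
    then show ?thesis
    proof (elim disjE exE conjE)
      assume "circuit_walk S ?W"
      then have "?val ?W = 0"
        by (rule tension_circuit_walk[OF f])
      then show ?thesis
        using B D P[THEN walk_edges] B(1)[THEN walk_edges] D(1)[THEN walk_edges]
        by (simp add: walk_val_append[of B])
    next
      fix h k
      assume *: "B = [h]" "D = [k]" "P = []" "fst h = fst k"
      then have "k = h \<or> k = flip h"
        using same_edge_cases by metis
      \<comment> \<open>A negative loop has equal orientations at both ends, so both directions of
        traversal give the same value.\<close>
      then show ?thesis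
        using * B(1,4) orient_flip[of h] by auto
    qed
  qed
qed

section \<open>Signs of circuit walks\<close>

lemma walk_sign_eq_prod:
  assumes "finite A" "edges_of hs \<subseteq> A"
  shows "walk_sign S hs = (\<Prod>e\<in>A. esign S e ^ count_list (map fst hs) e)"
  using assms(2)
proof (induction hs)
  case (Cons h hs)
  have "(\<Prod>e\<in>A. esign S e ^ count_list (map fst (h # hs)) e) =
    (\<Prod>e\<in>A. (if e = fst h then esign S e else 1) * esign S e ^ count_list (map fst hs) e)"
    by (intro prod.cong) auto
  also have "\<dots> = esign S (fst h) * walk_sign S hs"
    using Cons assms(1) by (simp add: prod.distrib)
  finally show ?case
    by simp
qed simp

lemma unbalanced_cycle_prod:
  assumes "unbalanced_cycle S C"
  shows "(\<Prod>e\<in>C. esign S e) = -1" "finite C" "C \<subseteq> edges S"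
proof -
  obtain hs v where hs: "edges_of hs = C" "walk S v hs v" "distinct (map fst hs)"
    using assms by (auto simp: unbalanced_cycle_def cycle_def cycle_walk_def closed_walk_iff)
  then show "C \<subseteq> edges S" "finite C"
    using walk_edges by (blast, auto simp: edges_of_def)
  then show "(\<Prod>e\<in>C. esign S e) = -1"
    using assms hs prod_edges_of[of hs] walk_sign_cases[of hs] by (auto simp: unbalanced_cycle_def)
qed

text \<open>The sign depends only on how often each edge is used. Circuit path edges contribute
  squares; what remains is a balanced cycle or two edge-disjoint unbalanced ones.\<close>

lemma circuit_walk_sign:
  assumes "circuit_walk S hs"
  shows "walk_sign S hs = 1"
proof -
  obtain C P where C: "circuit S C P" "edges_of hs = C"
    and count: "\<And>e. e \<in> C \<Longrightarrow> count_list (map fst hs) e = (if e \<in> P then 2 else 1)"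
    using assms by (auto simp: circuit_walk_def)
  have edges: "finite C" "C \<subseteq> edges S"
    using assms C(2) walk_edges unfolding circuit_walk_def closed_walk_iff
    by (simp add: edges_of_def flip: C(2), metis walk_edges)
  have "esign S e ^ 2 = 1" if "e \<in> C" for e
    using subsetD[OF edges(2) that] esign_cases[of e] by auto
  then have "walk_sign S hs = (\<Prod>e\<in>C. if e \<in> P then 1 else esign S e)"
    using edges C count by (subst walk_sign_eq_prod[of C]) (auto intro!: prod.cong)
  also have "\<dots> = (\<Prod>e\<in>C - P. esign S e)"
    using edges by (intro prod.mono_neutral_cong_right) auto
  also have "\<dots> = 1"
    using C(1)
  proof cases
    case balanced
    then show ?thesis
      by (simp add: balanced_cycle_def)
  next
    case (tight_handcuff C1 C2 v)
    then have "C1 \<inter> C2 = {}"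
      by (intro tight_handcuff_disjoint[of _ _ v]) (auto simp: unbalanced_cycle_def)
    then show ?thesis
      using tight_handcuff unbalanced_cycle_prod by (simp add: prod.union_disjoint)
  next
    case (loose_handcuff C1 C2 u ps w)
    then have "C - P = C1 \<union> C2"
      using path_disjoint[OF loose_handcuff(6,7)] path_disjoint[OF loose_handcuff(6,8)] by auto
    moreover have "C1 \<inter> C2 = {}"
      using loose_handcuff by (auto simp: edge_verts_def)
    ultimately show ?thesis
      using loose_handcuff unbalanced_cycle_prod by (simp add: prod.union_disjoint)
  qed
  finally show ?thesis .
qed

text \<open>A walk with a repeated departure is, up to rotation, B P D Q with simple closed
  \<open>B\<close> and \<open>D\<close>. A positive \<open>B\<close> or \<open>D\<close> can be
  removed; if both are negative, \<open>Q\<close> acts as the inverse of \<open>P\<close> and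
  \<open>handcuff_val\<close> applies.\<close>

lemma tension_positive_closed_walk:
  fixes f :: "'e \<Rightarrow> 'g::ab_group_add"
  assumes f: "tension S \<omega> f"
  shows "walk S v hs v \<Longrightarrow> walk_sign S hs = 1 \<Longrightarrow> walk_val S \<omega> f hs = 0"
proof (induction "length hs" arbitrary: v hs rule: less_induct)
  case less
  let ?val = "walk_val S \<omega> f" and ?sgn = "walk_sign S"
  note val = walk_val_append walk_val_reverse
  show ?case
  proof (cases "distinct (map (leaves S) hs)")
    case True
    show ?thesis
    proof (cases "distinct (map fst hs) \<and> hs \<noteq> []")
      case True
      then have "cycle_walk S hs"
        using less.prems \<open>distinct (map (leaves S) hs)\<close> by (auto simp: cycle_walk_def closed_walk_iff)
      then have "circuit S (edges_of hs) {}"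
        using True less.prems
        by (intro balanced) (auto simp: balanced_cycle_def cycle_def prod_edges_of)
      then have "circuit_walk S hs"
        using True less.prems
        by (auto simp: circuit_walk_def closed_walk_iff count_list_distinct edges_of_def
            intro!: exI[of _ "{}"])
      then show ?thesis
        by (rule tension_circuit_walk[OF f])
    next
      case False
      then consider "hs = []" | h where "hs = [h, flip h]"
        using closed_walk_distinct_edges[OF less.prems(1) \<open>distinct (map (leaves S) hs)\<close>] by auto
      then show ?thesis
      proof cases
        case (2 h)
        then have "fst h \<in> edges S"
          using less.prems by simp
        then show ?thesis
          using 2 esign_cases[of "fst h"] orient_cases[of h] orient_flip[of h] by auto
      qed simp
    qed
  next
    case False
    then have "hs \<noteq> []"
      by auto
    then obtain X B Y y where hs: "hs = X @ B @ Y" "walk S v X y" "walk S y Y v"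
      and B: "walk S y B y" "B \<noteq> []" "distinct (map (leaves S) B)"
      using closed_subwalk[OF less.prems(1)] by metis
    then have "Y @ X \<noteq> []"
      using False by auto
    moreover have "walk S y (Y @ X) y"
      using hs by auto
    ultimately obtain P D Q x where YX: "Y @ X = P @ D @ Q" and P: "walk S y P x"
      and Q: "walk S x Q y" and D: "walk S x D x" "D \<noteq> []" "distinct (map (leaves S) D)"
      using closed_subwalk[of y "Y @ X"] by metis
    have len: "length hs = length B + length P + length D + length Q"
      using hs arg_cong[OF YX, of length] by simp
    note edges = hs(2,3)[THEN walk_edges] B(1)[THEN walk_edges] P[THEN walk_edges]
      D(1)[THEN walk_edges] Q[THEN walk_edges]
    note sgn = edges[THEN walk_sign_cases]
    have YX_sgn: "?sgn Y * ?sgn X = ?sgn P * ?sgn D * ?sgn Q"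
      using arg_cong[OF YX, of ?sgn] by simp
    \<comment> \<open>Rotation is conjugation by \<open>X\<close>, which on an element of sign 1
      merely applies the sign of \<open>X\<close>.\<close>
    have "?val hs = sign_act (?sgn X) (?val (B @ Y @ X))"
      using hs(1) less.prems(2) sgn edges
      by (auto simp: val) (simp_all (no_asm) add: algebra_simps)?
    moreover have "?val (B @ P @ D @ Q) = 0"
    proof (cases "?sgn B = 1")
      case True
      have "?val B = 0"
        using B True len D by (intro less.hyps[of B y]) auto
      moreover have "?sgn P * ?sgn D * ?sgn Q = 1"
        using less.prems(2) hs(1) True YX_sgn by (simp add: mult.commute)
      then have "?val (P @ D @ Q) = 0"
        using B P D Q len by (intro less.hyps[of "P @ D @ Q" y]) (auto simp: mult.assoc)
      ultimately show ?thesis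
        using edges by (simp add: walk_val_append[of B])
    next
      case False
      then have neg: "?sgn B = -1" "?sgn P * ?sgn D * ?sgn Q = -1"
        using less.prems(2) hs(1) sgn YX_sgn by auto
      show ?thesis
      proof (cases "?sgn D = 1")
        case True
        have "?val D = 0"
          using D True len B by (intro less.hyps[of D x]) auto
        moreover have "?val (B @ P @ Q) = 0"
          using B P D Q len True neg by (intro less.hyps[of "B @ P @ Q" y]) auto
        ultimately show ?thesis
          using edges True sgn by (auto simp: val)
      next
        case False
        then have D': "?sgn D = -1"
          using sgn by auto
        then have PQ: "?val (P @ Q) = 0" "?sgn P = ?sgn Q"
          using B P D Q len neg sgn by (auto intro!: less.hyps[of "P @ Q" y])
        have Q': "?val Q = - sign_act (?sgn P) (?val P)"
          using PQ(1) sgn edges by (auto simp: val dest: minus_unique)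
        show ?thesis
        \<comment> \<open>Conjugating along the shorter of \<open>P\<close> and \<open>Q\<close>
          keeps the bound in \<open>handcuff_val\<close> at or below the length of
          \<open>hs\<close>.\<close>
        proof (cases "length P \<le> length Q")
          case True
          then have "?val B = ?val (P @ D @ reverse_walk P)"
            using len by (intro handcuff_val[OF f B neg(1) D D' P]) (auto intro: less.hyps)
          then show ?thesis
            using Q' PQ(2) neg(1) D' sgn edges
            by (auto simp: val) (simp_all (no_asm) add: algebra_simps)?
        next
          case False
          then have "?val B = ?val (reverse_walk Q @ D @ reverse_walk (reverse_walk Q))"
            using len
            by (intro handcuff_val[OF f B neg(1) D D' walk_reverse[OF Q]]) (auto intro: less.hyps)
          then show ?thesis
            using Q' PQ(2) neg(1) D' sgn edges
            by (auto simp: val) (simp_all (no_asm) add: algebra_simps)?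
        qed
      qed
    qed
    ultimately show ?thesis
      by (simp add: YX)
  qed
qed

text \<open>The converse direction holds because every circuit walk is a positive closed walk, by
  \<open>circuit_walk_sign\<close>. This frees the later arguments from circuits.\<close>

lemma tension_iff:
  "tension S \<omega> f \<longleftrightarrow>
    (\<forall>v hs. walk S v hs v \<longrightarrow> walk_sign S hs = 1 \<longrightarrow> walk_val S \<omega> f hs = 0)"
proof (intro iffI allI impI)
  assume *: "\<forall>v hs. walk S v hs v \<longrightarrow> walk_sign S hs = 1 \<longrightarrow> walk_val S \<omega> f hs = 0"
  show "tension S \<omega> f"
    unfolding tension_def
  proof (intro allI impI)
    fix hs
    assume hs: "circuit_walk S hs"
    then obtain v where v: "walk S v hs v"
      by (auto simp: circuit_walk_def closed_walk_iff)
    then show "(\<Sum>i<length hs. sign_act (\<omega> (hs ! i) * (\<Prod>j<i. esign S (fst (hs ! j))))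
        (f (fst (hs ! i)))) = 0"
      using * circuit_walk_sign[OF hs] walk_edges[OF v] by (simp add: walk_val_eq_sum)
  qed
qed (rule tension_positive_closed_walk)

lemma parallel_walk_val:
  assumes "tension S \<omega> f" "walk S u A v" "walk S u C v" "walk_sign S A = walk_sign S C"
  shows "walk_val S \<omega> f A = walk_val S \<omega> f C"
proof -
  note edges = assms(2,3)[THEN walk_edges]
  note sgn = edges[THEN walk_sign_cases]
  have "walk_val S \<omega> f (A @ reverse_walk C) = 0"
    using assms sgn
    by (intro tension_positive_closed_walk[of _ u]) (auto intro: walk_reverse)
  then show ?thesis
    using assms(4) edges sgn by (auto simp: walk_val_append walk_val_reverse)
qed

text \<open>Simple closed stretches of sign 1 can be cut out without changing the sign, until a
  negative one appears.\<close>

lemma negative_closed_walk_cycle: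
  "walk S v hs v \<Longrightarrow> walk_sign S hs = -1 \<Longrightarrow>
   \<exists>P B z. walk S v P z \<and> walk S z B z \<and> B \<noteq> [] \<and> distinct (map (leaves S) B) \<and> walk_sign S B = -1"
proof (induction "length hs" arbitrary: hs rule: less_induct)
  case less
  then have "hs \<noteq> []"
    by auto
  then obtain A B C z where *: "hs = A @ B @ C" "walk S v A z" "walk S z B z" "walk S z C v"
    "B \<noteq> []" "distinct (map (leaves S) B)"
    using closed_subwalk[OF less.prems(1)] by metis
  show ?case
  proof (cases "walk_sign S B = -1")
    case False
    then have "walk_sign S (A @ C) = -1"
      using * less.prems(2) walk_sign_cases[OF walk_edges[OF *(3)]] by auto
    then show ?thesis
      using * by (intro less.hyps[of "A @ C"]) auto
  qed (use * in blast)
qed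

subsection \<open>Components\<close>

definition reachable :: "('v \<times> 'v) set" where
  "reachable = {(u, v). u \<in> verts S \<and> v \<in> verts S \<and> (\<exists>hs. walk S u hs v)}"

lemma reachable_iff: "(u, v) \<in> reachable \<longleftrightarrow> (\<exists>hs. walk S u hs v)"
  by (auto simp: reachable_def dest: walk_in_verts)

lemma equiv_reachable: "equiv (verts S) reachable"
proof (rule equivI)
  show "refl_on (verts S) reachable"
    by (auto simp: refl_on_def reachable_iff intro: exI[of _ "[]"])
  show "reachable \<subseteq> verts S \<times> verts S"
    by (auto simp: reachable_def)
  show "sym reachable"
    by (auto simp: sym_def reachable_iff intro: walk_reverse)
  show "trans reachable"
    by (auto simp: trans_def reachable_iff)
qed

definition root :: "'v \<Rightarrow> 'v" where
  "root v = (SOME u. (v, u) \<in> reachable)"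

lemma root_reachable: "v \<in> verts S \<Longrightarrow> (v, root v) \<in> reachable"
  unfolding root_def by (rule someI[of _ v]) (auto simp: reachable_iff intro: exI[of _ "[]"])

text \<open>Equivalent vertices satisfy the same predicate, so \<open>SOME\<close> makes the same
  choice for both.\<close>

lemma root_cong:
  assumes "(u, v) \<in> reachable"
  shows "root u = root v"
proof -
  have "(u, w) \<in> reachable \<longleftrightarrow> (v, w) \<in> reachable" for w
    using equiv_class_eq[OF equiv_reachable assms] by blast
  then show ?thesis
    by (simp add: root_def)
qed

definition roots :: "'v set" where
  "roots = root ` verts S"

definition balanced_roots :: "'v set" where
  "balanced_roots = {r \<in> roots. \<nexists>hs. walk S r hs r \<and> walk_sign S hs = -1}"

lemma roots_subset: "roots \<subseteq> verts S"
  using root_reachable by (auto simp: roots_def reachable_def)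

lemma root_idem: "v \<in> verts S \<Longrightarrow> root (root v) = root v"
  using root_cong[OF root_reachable] by simp

lemma in_roots_iff: "v \<in> verts S \<Longrightarrow> v \<in> roots \<longleftrightarrow> root v = v"
  by (auto simp: roots_def root_idem) (metis image_eqI)

text \<open>A negative closed walk at \<open>r\<close> yields a negative cycle inside the component;
  conversely, a negative cycle is carried back to \<open>r\<close> by conjugating with a
  walk.\<close>

lemma balanced_component_iff:
  assumes "r \<in> verts S"
  shows "balanced_component S (reachable `` {r}) \<longleftrightarrow>
    (\<nexists>hs. walk S r hs r \<and> walk_sign S hs = -1)"
proof -
  have comp: "reachable `` {r} \<in> components S"
    unfolding components_def reachable_def[symmetric] using assms by (rule quotientI)
  show ?thesis
  proof (intro iffI notI)
    assume bal: "balanced_component S (reachable `` {r})"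
    assume "\<exists>hs. walk S r hs r \<and> walk_sign S hs = -1"
    then obtain P B z where P: "walk S r P z"
      and B: "walk S z B z" "B \<noteq> []" "distinct (map (leaves S) B)" "walk_sign S B = -1"
      using negative_closed_walk_cycle by metis
    have "edge_verts S (edges_of B) \<subseteq> reachable `` {r}"
    proof
      fix x
      assume "x \<in> edge_verts S (edges_of B)"
      then obtain A where "walk S z A x"
        using edge_verts_closed[OF B(1,2)] walk_split_leaves[OF B(1)] by metis
      then show "x \<in> reachable `` {r}"
        using P by (auto simp: reachable_iff)
    qed
    then show False
      using bal negative_simple_closed_walk[OF B]
      by (auto simp: balanced_component_def unbalanced_cycle_def balanced_cycle_def)
  next
    assume *: "\<nexists>hs. walk S r hs r \<and> walk_sign S hs = -1"
    have "balanced_cycle S C" if C: "cycle S C" "edge_verts S C \<subseteq> reachable `` {r}" for C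
    proof (rule ccontr)
      assume "\<not> balanced_cycle S C"
      then have "unbalanced_cycle S C"
        using C by (simp add: balanced_cycle_def unbalanced_cycle_def)
      obtain hs v where hs: "edges_of hs = C" "walk S v hs v" "hs \<noteq> []" "distinct (map fst hs)"
        using C by (auto simp: cycle_def cycle_walk_def closed_walk_iff)
      then have "walk_sign S hs = -1"
        using prod_edges_of unbalanced_cycle_prod(1)[OF \<open>unbalanced_cycle S C\<close>] by auto
      moreover have "v \<in> reachable `` {r}"
        using edge_verts_closed[OF hs(2,3)] C hs(1) by auto
      then obtain P where "walk S r P v"
        by (auto simp: reachable_iff)
      ultimately have "walk S r (P @ hs @ reverse_walk P) r" "walk_sign S (P @ hs @ reverse_walk P) = -1"
        using hs walk_sign_cases[OF walk_edges[OF \<open>walk S r P v\<close>]]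
        by (auto intro!: walk_appendI walk_reverse)
      then show False
        using * by blast
    qed
    then show "balanced_component S (reachable `` {r})"
      using comp by (auto simp: balanced_component_def)
  qed
qed

lemma bij_betw_roots_components: "bij_betw (\<lambda>r. reachable `` {r}) roots (components S)"
proof (rule bij_betw_imageI)
  show "inj_on (\<lambda>r. reachable `` {r}) roots"
  proof (rule inj_onI)
    fix r s
    assume "r \<in> roots" "s \<in> roots" "reachable `` {r} = reachable `` {s}"
    moreover from this have "(r, s) \<in> reachable"
      using equiv_reachable roots_subset by (meson eq_equiv_class subsetD)
    ultimately show "r = s"
      using root_cong in_roots_iff roots_subset by (metis subsetD)
  qed
  have "reachable `` {v} = reachable `` {root v}" if "v \<in> verts S" for v
    using root_reachable[OF that] equiv_reachable by (metis equiv_class_eq)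
  then have "(\<lambda>r. reachable `` {r}) ` roots = (\<lambda>v. reachable `` {v}) ` verts S"
    by (force simp: roots_def)
  then show "(\<lambda>r. reachable `` {r}) ` roots = components S"
    by (auto simp: components_def quotient_def reachable_def[symmetric])
qed

lemma card_roots:
  "card roots = num_components S" "card balanced_roots = num_balanced S"
  "card (roots - balanced_roots) = num_unbalanced S"
proof -
  show "card roots = num_components S"
    unfolding num_components_def by (rule bij_betw_same_card[OF bij_betw_roots_components])
  have comp: "components S = (\<lambda>r. reachable `` {r}) ` roots"
    using bij_betw_imp_surj_on[OF bij_betw_roots_components] by simp
  have image: "(\<lambda>r. reachable `` {r}) ` {r \<in> roots. Q (reachable `` {r})} = {X \<in> components S. Q X}" for Q
    by (auto simp: comp)
  have card: "card {r \<in> roots. Q (reachable `` {r})} = card {X \<in> components S. Q X}" for Q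
    using bij_betw_roots_components unfolding image[symmetric]
    by (intro card_image[symmetric]) (auto simp: bij_betw_def elim: inj_on_subset)
  have b: "balanced_roots = {r \<in> roots. balanced_component S (reachable `` {r})}"
    using balanced_component_iff roots_subset by (auto simp: balanced_roots_def)
  show "card balanced_roots = num_balanced S"
    unfolding num_balanced_def b by (rule card)
  have "roots - balanced_roots = {r \<in> roots. \<not> balanced_component S (reachable `` {r})}"
    using b by auto
  then show "card (roots - balanced_roots) = num_unbalanced S"
    unfolding num_unbalanced_def using card[of "\<lambda>X. \<not> balanced_component S X"] by simp
qed

subsection \<open>Parametrising tensions\<close>

text \<open>Any one walk from the root serves. The empty choice at a root gives value 0 and sign 1
  there, in line with \<open>potential\<close>.\<close>

definition tree_walk :: "'v \<Rightarrow> ('e \<times> bool) list" where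
  "tree_walk v = (if root v = v then [] else SOME hs. walk S (root v) hs v)"

text \<open>Meaningful only where a negative closed walk exists; elsewhere \<open>SOME\<close>
  returns an arbitrary list.\<close>

definition negative_walk :: "'v \<Rightarrow> ('e \<times> bool) list" where
  "negative_walk r = (SOME hs. walk S r hs r \<and> walk_sign S hs = -1)"

lemma walk_tree_walk: "v \<in> verts S \<Longrightarrow> walk S (root v) (tree_walk v) v"
proof -
  assume "v \<in> verts S"
  then have "\<exists>hs. walk S (root v) hs v"
    using root_reachable walk_reverse unfolding reachable_iff by blast
  then show ?thesis
    using \<open>v \<in> verts S\<close> by (auto simp: tree_walk_def intro: someI_ex)
qed

lemma negative_walk:
  assumes "walk S r hs r" "walk_sign S hs = -1"
  shows "walk S r (negative_walk r) r" "walk_sign S (negative_walk r) = -1"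
  using someI[of "\<lambda>hs. walk S r hs r \<and> walk_sign S hs = -1" hs] assms
  by (auto simp: negative_walk_def)

abbreviation tree_sign :: "'v \<Rightarrow> int" where
  "tree_sign v \<equiv> walk_sign S (tree_walk v)"

lemma tree_sign_cases: "v \<in> verts S \<Longrightarrow> tree_sign v \<in> {-1, 1}"
  using walk_tree_walk walk_edges walk_sign_cases by blast

lemma tree_root:
  assumes "r \<in> roots"
  shows "root r = r" "tree_walk r = []"
  using assms in_roots_iff roots_subset by (auto simp: tree_walk_def)

text \<open>
  A parameter at a vertex that is not a root is the value of its tree walk; at the root of an
  unbalanced component it is the value of the negative closed walks there.
\<close>

definition parameters :: "'v set" where
  "parameters = verts S - balanced_roots"

definition potential :: "('v \<Rightarrow> 'g::ab_group_add) \<Rightarrow> 'v \<Rightarrow> 'g" where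
  "potential q v = (if v \<in> roots then 0 else q v)"

text \<open>
  \<open>edge_term q u s v\<close> is the value forced on a walk of sign \<open>s\<close> from \<open>u\<close> to \<open>v\<close>: closing it up by
  the tree walks gives a closed walk at the root of sign \<open>t\<close>, whose value is \<open>0\<close> or \<open>q (root u)\<close>.
\<close>

definition edge_term :: "('v \<Rightarrow> 'g::ab_group_add) \<Rightarrow> 'v \<Rightarrow> int \<Rightarrow> 'v \<Rightarrow> 'g" where
  "edge_term q u s v = (let t = tree_sign u * s * tree_sign v in
     sign_act (tree_sign u)
       ((if t = 1 then 0 else q (root u)) - potential q u + sign_act t (potential q v)))"

text \<open>The factor \<omega> cancels the one that \<open>walk_val\<close> applies to the same
  half-edge. The choice of \<open>True\<close> is immaterial by
  \<open>of_parameters_half_edge\<close>.\<close>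

definition of_parameters :: "('v \<Rightarrow> 'g::ab_group_add) \<Rightarrow> 'e \<Rightarrow> 'g" where
  "of_parameters q = (\<lambda>e\<in>edges S. sign_act (\<omega> (e, True))
     (edge_term q (leaves S (e, True)) (esign S e) (arrives S (e, True))))"

definition to_parameters :: "('e \<Rightarrow> 'g::ab_group_add) \<Rightarrow> 'v \<Rightarrow> 'g" where
  "to_parameters f = (\<lambda>v\<in>parameters.
     walk_val S \<omega> f (if v \<in> roots then negative_walk v else tree_walk v))"

lemma root_edge: "fst h \<in> edges S \<Longrightarrow> root (leaves S h) = root (arrives S h)"
  by (rule root_cong) (auto simp: reachable_iff arrives_in_verts intro!: exI[of _ "[h]"])

text \<open>Reversing the edge multiplies \<open>edge_term\<close> by minus the edge sign, and
  \<open>orient_flip\<close> says the same of \<omega>.\<close>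

lemma of_parameters_half_edge:
  assumes "fst h \<in> edges S"
  shows "sign_act (\<omega> h) (of_parameters q (fst h)) =
    edge_term q (leaves S h) (esign S (fst h)) (arrives S h)"
proof -
  define k where "k = (fst h, True)"
  have k: "fst k = fst h" "fst k \<in> edges S"
    using assms by (auto simp: k_def)
  have f: "of_parameters q (fst h) =
      sign_act (\<omega> k) (edge_term q (leaves S k) (esign S (fst k)) (arrives S k))"
    using assms by (simp add: of_parameters_def k_def)
  note signs = esign_cases[OF k(2)] orient_cases[OF k(2)] tree_sign_cases[OF leaves_in_verts[OF k(2)]]
    tree_sign_cases[OF arrives_in_verts[OF k(2)]]
  have "h = k \<or> h = flip k"
    using same_edge_cases[of k h] k(1) by simp
  then show ?thesis
  proof
    assume "h = k"
    then show ?thesis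
      using signs(2) f by auto
  next
    assume "h = flip k"
    then show ?thesis
      using signs f orient_flip[OF k(2)] root_edge[OF k(2)]
      by (auto simp: edge_term_def) (simp_all (no_asm) add: algebra_simps)?
  qed
qed

text \<open>The root values, 0 for sign 1 and \<open>q (root u)\<close> for sign -1, compose
  consistently since elements of sign -1 are involutions; potentials at intermediate vertices
  cancel.\<close>

lemma of_parameters_walk:
  "walk S u hs v \<Longrightarrow> walk_val S \<omega> (of_parameters q) hs = edge_term q u (walk_sign S hs) v"
proof (induction hs arbitrary: u)
  case Nil
  then show ?case
    using tree_sign_cases[of u] by (auto simp: edge_term_def)
next
  case (Cons h hs)
  let ?w = "arrives S h"
  have h: "fst h \<in> edges S" "leaves S h = u" and hs: "walk S ?w hs v"
    using Cons.prems by auto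
  have verts: "u \<in> verts S" "v \<in> verts S" "?w \<in> verts S"
    using walk_in_verts Cons.prems hs by blast+
  have "walk_val S \<omega> (of_parameters q) (h # hs) = edge_term q u (esign S (fst h)) ?w +
    sign_act (esign S (fst h)) (edge_term q ?w (walk_sign S hs) v)"
    using Cons.IH[OF hs] of_parameters_half_edge[OF h(1), of q] h(2) by simp
  also have "\<dots> = edge_term q u (walk_sign S (h # hs)) v"
    using verts[THEN tree_sign_cases] esign_cases[OF h(1)] walk_sign_cases[OF walk_edges[OF hs]]
      root_edge[OF h(1)] h(2)
    by (auto simp: edge_term_def) (simp_all (no_asm) add: algebra_simps)?
  finally show ?case .
qed

lemma of_parameters_tension: "of_parameters q \<in> tensions S \<omega>"
proof -
  have "walk_val S \<omega> (of_parameters q) hs = 0" if "walk S v hs v" "walk_sign S hs = 1" for v hs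
    using of_parameters_walk[OF that(1), of q] that(2) tree_sign_cases[of v] walk_in_verts[OF that(1)]
    by (auto simp: edge_term_def)
  then show ?thesis
    by (auto simp: tensions_def tension_iff of_parameters_def)
qed

text \<open>At a root the tree walk is empty and the potential 0, so the negative walk has value
  \<open>q v\<close>. At another vertex the tree walk closes up with sign 1, leaving only the
  potential.\<close>

lemma to_parameters_of_parameters:
  assumes "q \<in> parameters \<rightarrow>\<^sub>E UNIV"
  shows "to_parameters (of_parameters q) = q"
proof
  fix v
  show "to_parameters (of_parameters q) v = q v"
  proof (cases "v \<in> parameters")
    case v: True
    then have "v \<in> verts S"
      by (simp add: parameters_def)
    show ?thesis
    proof (cases "v \<in> roots")
      case True
      then obtain hs where "walk S v hs v" "walk_sign S hs = -1"
        using v by (auto simp: parameters_def balanced_roots_def)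
      then show ?thesis
        using v True of_parameters_walk[OF negative_walk(1), of v hs q] negative_walk(2) tree_root[OF True]
        by (simp add: to_parameters_def edge_term_def potential_def)
    next
      case False
      moreover have "root v \<in> roots"
        using \<open>v \<in> verts S\<close> by (simp add: roots_def)
      ultimately show ?thesis
        using v of_parameters_walk[OF walk_tree_walk[OF \<open>v \<in> verts S\<close>], of q] tree_root[of "root v"]
          tree_sign_cases[OF \<open>v \<in> verts S\<close>]
        by (auto simp: to_parameters_def edge_term_def potential_def)
    qed
  next
    case False
    then show ?thesis
      using assms by (auto simp: to_parameters_def PiE_def extensional_def)
  qed
qed

text \<open>Closing an edge by tree walks gives a closed walk at the root of known value: 0 if
  positive, the parameter of the root if negative. Solving for the edge reproduces
  \<open>edge_term\<close>.\<close>

lemma of_parameters_to_parameters: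
  fixes f :: "'e \<Rightarrow> 'g::ab_group_add"
  assumes "f \<in> tensions S \<omega>"
  shows "of_parameters (to_parameters f) = f"
proof
  fix e
  have f: "tension S \<omega> f" "f \<in> extensional (edges S)"
    using assms by (auto simp: tensions_def PiE_def)
  show "of_parameters (to_parameters f) e = f e"
  proof (cases "e \<in> edges S")
    case True
    define h where "h = (e, True)"
    have h: "fst h \<in> edges S"
      using True by (simp add: h_def)
    define u where "u = leaves S h"
    define v where "v = arrives S h"
    let ?r = "root u"
    have verts: "u \<in> verts S" "v \<in> verts S"
      using h by (simp_all add: u_def v_def leaves_in_verts arrives_in_verts)
    have rv: "root v = ?r"
      using root_edge[OF h] by (simp add: u_def v_def)
    \<comment> \<open>At roots both sides are 0 because the tree walk is empty; every other vertex
      is a parameter.\<close>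
    have pot: "potential (to_parameters f) w = walk_val S \<omega> f (tree_walk w)" if "w \<in> verts S" for w
      using that by (auto simp: potential_def to_parameters_def parameters_def balanced_roots_def tree_root)
    have walks: "walk S ?r (tree_walk u) u" "walk S u [h] v" "walk S ?r (tree_walk v) v"
      using walk_tree_walk[OF verts(1)] walk_tree_walk[OF verts(2)] verts(2) rv h
      by (auto simp: u_def v_def)
    let ?W = "tree_walk u @ [h] @ reverse_walk (tree_walk v)"
    have W: "walk S ?r ?W ?r"
      using walks by (auto intro!: walk_reverse walk_appendI)
    have "?r \<in> roots"
      using verts by (simp add: roots_def)
    have "walk_val S \<omega> f ?W = to_parameters f ?r" if "walk_sign S ?W = -1"
    proof -
      have "?r \<in> parameters"
        using that W \<open>?r \<in> roots\<close> roots_subset by (auto simp: parameters_def balanced_roots_def)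
      then show ?thesis
        using parallel_walk_val[OF f(1) W negative_walk(1)[OF W that]] negative_walk(2)[OF W that]
          that \<open>?r \<in> roots\<close> by (simp add: to_parameters_def)
    qed
    moreover have "walk_val S \<omega> f ?W = 0" if "walk_sign S ?W = 1"
      using f(1) W that tension_iff by blast
    moreover note signs = esign_cases[OF h] verts[THEN tree_sign_cases] orient_cases[OF h]
    ultimately have "sign_act (\<omega> h) (f (fst h)) = edge_term (to_parameters f) u (esign S (fst h)) v"
      using walks[THEN walk_edges] pot[OF verts(1)] pot[OF verts(2)]
      by (auto simp: edge_term_def walk_val_append walk_val_reverse) (simp_all add: algebra_simps)?
    from this[symmetric] show ?thesis
      using True signs(4) by (auto simp: of_parameters_def h_def u_def v_def)
  next
    case False
    then show ?thesis
      using f by (auto simp: of_parameters_def extensional_def)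
  qed
qed

text \<open>The predicate lets one bijection give both counts: constantly true for tensions, a
  condition at unbalanced roots for potential differences.\<close>

lemma card_tensions_subset:
  fixes R :: "('v \<Rightarrow> 'g::ab_group_add) \<Rightarrow> bool"
  shows "card {f \<in> tensions S \<omega>. R (to_parameters f)} = card {q \<in> parameters \<rightarrow>\<^sub>E UNIV. R q}"
proof -
  have "bij_betw to_parameters {f \<in> tensions S \<omega>. R (to_parameters f)} {q \<in> parameters \<rightarrow>\<^sub>E UNIV. R q}"
    using of_parameters_to_parameters to_parameters_of_parameters of_parameters_tension
    by (intro bij_betw_byWitness[where f' = of_parameters]) (auto simp: to_parameters_def)
  then show ?thesis
    by (rule bij_betw_same_card)
qed

text \<open>The values of negative closed walks in one component agree modulo 2G, so a single one at
  the root tests all its unbalanced cycles.\<close>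

lemma potential_difference_iff:
  fixes f :: "'e \<Rightarrow> 'g::ab_group_add"
  assumes f: "tension S \<omega> f"
  shows "potential_difference S \<omega> f \<longleftrightarrow> (\<forall>r\<in>roots - balanced_roots. to_parameters f r \<in> doubles)"
proof -
  have sum: "(\<Sum>i<length hs. f (fst (hs ! i))) \<in> doubles \<longleftrightarrow> walk_val S \<omega> f hs \<in> doubles"
    for hs
    using doubles_diff_iff[OF walk_val_minus_sum_doubles[of S \<omega> f hs]]
    by (simp add: sum.list_conv_set_nth atLeast0LessThan)
  have conj: "walk_val S \<omega> f (negative_walk r) \<in> doubles \<longleftrightarrow> walk_val S \<omega> f B \<in> doubles"
    if P: "walk S r P z" and B: "walk S z B z" "walk_sign S B = -1" for r P z B
  proof -
    note edges = P[THEN walk_edges] B(1)[THEN walk_edges]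
    let ?W = "P @ B @ reverse_walk P"
    have W: "walk S r ?W r" "walk_sign S ?W = -1"
      using P B walk_sign_cases[OF edges(1)] by (auto intro!: walk_appendI walk_reverse)
    have "walk_val S \<omega> f (negative_walk r) = walk_val S \<omega> f ?W"
      using negative_walk[OF W] W by (intro parallel_walk_val[OF f]) auto
    \<comment> \<open>The two passes along \<open>P\<close> add up instead of cancelling, because
      \<open>B\<close> between them is negative.\<close>
    also have "\<dots> = (walk_val S \<omega> f P + walk_val S \<omega> f P) + sign_act (walk_sign S P) (walk_val S \<omega> f B)"
      using edges B(2) walk_sign_cases[OF edges(1)]
      by (auto simp: walk_val_append walk_val_reverse algebra_simps)
    also have "\<dots> \<in> doubles \<longleftrightarrow> walk_val S \<omega> f B \<in> doubles"
      by (simp add: double_add_doubles_iff sign_act_doubles_iff)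
    finally show ?thesis .
  qed
  have param: "to_parameters f r = walk_val S \<omega> f (negative_walk r)" if "r \<in> roots - balanced_roots" for r
    using that roots_subset by (auto simp: to_parameters_def parameters_def)
  show ?thesis
  proof (intro iffI ballI)
    fix r
    assume pd: "potential_difference S \<omega> f" and r: "r \<in> roots - balanced_roots"
    then obtain hs where "walk S r hs r" "walk_sign S hs = -1"
      by (auto simp: balanced_roots_def)
    then obtain P B z where P: "walk S r P z"
      and B: "walk S z B z" "B \<noteq> []" "distinct (map (leaves S) B)" "walk_sign S B = -1"
      using negative_closed_walk_cycle by metis
    have "walk_val S \<omega> f B \<in> doubles"
      using pd negative_simple_closed_walk[OF B] sum[of B]
      by (auto simp: potential_difference_def)
    then show "to_parameters f r \<in> doubles"
      using conj[OF P B(1,4)] param[OF r] by simp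
  next
    assume *: "\<forall>r\<in>roots - balanced_roots. to_parameters f r \<in> doubles"
    have "walk_val S \<omega> f hs \<in> doubles"
      if hs: "cycle_walk S hs" "unbalanced_cycle S (edges_of hs)" for hs
    proof -
      obtain v where v: "walk S v hs v" "distinct (map fst hs)"
        using hs(1) by (auto simp: cycle_walk_def closed_walk_iff)
      have neg: "walk_sign S hs = -1"
        using prod_edges_of[OF v(2)] unbalanced_cycle_prod(1)[OF hs(2)] by simp
      have "v \<in> verts S"
        using walk_in_verts[OF v(1)] by simp
      note P = walk_tree_walk[OF this]
      have "walk S (root v) (tree_walk v @ hs @ reverse_walk (tree_walk v)) (root v)"
        "walk_sign S (tree_walk v @ hs @ reverse_walk (tree_walk v)) = -1"
        using P v(1) neg walk_sign_cases[OF walk_edges[OF P]]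
        by (auto intro!: walk_appendI walk_reverse)
      then have "root v \<in> roots - balanced_roots"
        using \<open>v \<in> verts S\<close> by (auto simp: balanced_roots_def roots_def)
      then show ?thesis
        using * conj[OF P v(1) neg] param by auto
    qed
    then show "potential_difference S \<omega> f"
      using f sum by (auto simp: potential_difference_def)
  qed
qed

section \<open>Counting the parameters\<close>

lemma finite_parameters: "finite parameters"
  and card_parameters: "card parameters = card (verts S) - num_balanced S"
  and card_parameters_not_roots: "card (parameters - roots) = card (verts S) - num_components S"
proof -
  have fin: "finite (verts S)"
    using signed_graph by (simp add: signed_graph_def)
  have sub: "balanced_roots \<subseteq> roots"
    by (auto simp: balanced_roots_def)
  show "finite parameters"
    using fin by (simp add: parameters_def)
  show "card parameters = card (verts S) - num_balanced S"
    unfolding parameters_def using sub roots_subset fin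
    by (subst card_Diff_subset) (auto simp: card_roots intro: finite_subset)
  have "parameters - roots = verts S - roots"
    using sub by (auto simp: parameters_def)
  then show "card (parameters - roots) = card (verts S) - num_components S"
    using roots_subset fin by (simp add: card_Diff_subset card_roots finite_subset)
qed

lemma card_tensions:
  "card (tensions S \<omega> :: ('e \<Rightarrow> 'g::{ab_group_add, finite}) set) =
   CARD('g) ^ (card (verts S) - num_balanced S)"
  using card_tensions_subset[of "\<lambda>_ :: 'v \<Rightarrow> 'g. True"]
  by (simp add: card_PiE finite_parameters card_parameters)

text \<open>Parameters at roots belong to the unbalanced components and range over 2G; the others
  are the non-root vertices and range over G.\<close>

lemma card_potential_differences:
  "card (potential_differences S \<omega> :: ('e \<Rightarrow> 'g::{ab_group_add, finite}) set) =
   CARD('g) ^ (card (verts S) - num_components S) * card (doubles :: 'g set) ^ num_unbalanced S"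
proof -
  let ?R = "\<lambda>q :: 'v \<Rightarrow> 'g. \<forall>r\<in>roots - balanced_roots. q r \<in> doubles"
  let ?A = "\<lambda>v. if v \<in> roots then doubles else UNIV :: 'g set"
  have sub: "roots - balanced_roots = parameters \<inter> roots"
    using roots_subset by (auto simp: parameters_def)
  have "(potential_differences S \<omega> :: ('e \<Rightarrow> 'g) set) = {f \<in> tensions S \<omega>. ?R (to_parameters f)}"
    using potential_difference_iff
    by (auto simp: potential_differences_def tensions_def potential_difference_def)
  then have "card (potential_differences S \<omega> :: ('e \<Rightarrow> 'g) set) = card {q \<in> parameters \<rightarrow>\<^sub>E UNIV. ?R q}"
    using card_tensions_subset[of ?R] by simp
  also have "{q \<in> parameters \<rightarrow>\<^sub>E UNIV. ?R q} = Pi\<^sub>E parameters ?A"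
    unfolding sub set_eq_iff mem_Collect_eq PiE_iff by (auto split: if_splits)
  also have "card \<dots> = (\<Prod>v\<in>parameters. card (?A v))"
    by (rule card_PiE[OF finite_parameters])
  also have "\<dots> = (\<Prod>v\<in>parameters - roots. CARD('g)) * (\<Prod>v\<in>parameters \<inter> roots. card (doubles :: 'g set))"
    by (subst prod.Int_Diff[OF finite_parameters, of _ roots]) (simp add: mult.commute)
  also have "\<dots> = CARD('g) ^ (card (verts S) - num_components S) * card (doubles :: 'g set) ^ num_unbalanced S"
    by (simp add: card_parameters_not_roots card_roots flip: sub)
  finally show ?thesis .
qed

end

theorem theorem7p7:
  fixes S :: "('v, 'e) sgraph" and \<omega> :: "'e \<times> bool \<Rightarrow> int"
  assumes "signed_graph S" and "compatible_orientation S \<omega>"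
  shows "card (tensions S \<omega> :: ('e \<Rightarrow> 'g::{ab_group_add, finite}) set) =
           CARD('g) ^ (card (verts S) - num_balanced S) \<and>
         card (potential_differences S \<omega> :: ('e \<Rightarrow> 'g) set) =
           CARD('g) ^ (card (verts S) - num_components S) *
           card (doubles :: 'g set) ^ num_unbalanced S"
proof -
  interpret oriented_signed_graph S \<omega>
    using assms by unfold_locales
  show ?thesis
    using card_tensions card_potential_differences by blast
qed

end
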